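(* For every $\ell\ge 1$, let $c(\mathcal L_\ell)$ be the central arrangement in $\mathbb C^{\ell+1}$ (coordinates $x_0,x_1,\dots,x_\ell$) consisting of the hyperplanes $\{x_0=0\}$ and $\{x_i-x_j-x_0=0\}$ for $1\le i<j\le\ell$ (the cone of the Linial arrangement). Then its Falk invariant is $\phi_3(c(\mathcal L_\ell))=0$.
   Context: Falk invariant: for a central arrangement with hyperplanes $H_0,\dots,H_n$, $H_i=\alpha_i^{-1}(0)$, let $E$ be the exterior algebra over $\mathbb C$ on $e_0,\dots,e_n$ with degree-$p$ part $E^p$, and $\partial$ the degree $-1$ derivation with $\partial e_i=1$. A subset $S$ is dependent if $\{\alpha_i:i\in S\}$ is linearly dependent. The Orlik–Solomon ideal $I$ is generated by $\partial e_S$ for $S$ dependent ($e_S$ the ordered wedge of $e_i$, $i\in S$), $I^p=I\cap E^p$, and $\phi_3=\dim\ker(E^1\otimes I^2\to E^3,\ a\otimes b\mapsto a\wedge b)$. *)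

theory Defs
  imports Complex_Main "HOL-Library.Function_Algebras"
begin

subsection \<open>Complex vector spaces of functions\<close>

definition fscale :: "complex \<Rightarrow> ('a \<Rightarrow> complex) \<Rightarrow> 'a \<Rightarrow> complex" where
  "fscale c f = (\<lambda>x. c * f x)"

lemma fscale_apply [simp]: "fscale c f x = c * f x"
  by (simp add: fscale_def)

interpretation fun_space: vector_space "fscale :: complex \<Rightarrow> ('a \<Rightarrow> complex) \<Rightarrow> 'a \<Rightarrow> complex"
  by unfold_locales (auto simp: fun_eq_iff algebra_simps)

lemma sum_fun_apply: "(\<Sum>i\<in>A. f i) x = (\<Sum>i\<in>A. f i x)"
  by (induction A rule: infinite_finite_induct) auto

subsection \<open>The exterior algebra on \<open>e\<^sub>0, \<dots>, e\<^sub>n\<close>\<close>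

text \<open>
  An element of the exterior algebra is given by its coordinates in the monomial basis
  \<open>e\<^sub>S\<close>, \<open>S \<subseteq> {0, \<dots>, n}\<close>, where \<open>e\<^sub>S\<close> is the wedge of the \<open>e\<^sub>i\<close>, \<open>i \<in> S\<close>, in increasing order.
  The coordinate functions vanish on all sets that are not subsets of \<open>{..n}\<close>.
\<close>

type_synonym ext = "nat set \<Rightarrow> complex"

definition ext_alg :: "nat \<Rightarrow> ext set" where
  "ext_alg n = {a. \<forall>S. a S \<noteq> 0 \<longrightarrow> S \<subseteq> {..n}}"

definition ext_deg :: "nat \<Rightarrow> nat \<Rightarrow> ext set" where
  "ext_deg n p = {a. \<forall>S. a S \<noteq> 0 \<longrightarrow> S \<subseteq> {..n} \<and> card S = p}"

definition ext_mono :: "nat set \<Rightarrow> ext" where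
  "ext_mono S = (\<lambda>T. if T = S then 1 else 0)"

text \<open>The sign with \<open>e\<^sub>S \<and> e\<^sub>T = \<plusminus>e\<^bsub>S \<union> T\<^esub>\<close> for disjoint \<open>S\<close>, \<open>T\<close>: it counts inversions.\<close>

definition ext_sign :: "nat set \<Rightarrow> nat set \<Rightarrow> complex" where
  "ext_sign S T = (-1) ^ card {(i, j). i \<in> S \<and> j \<in> T \<and> j < i}"

definition wedge :: "ext \<Rightarrow> ext \<Rightarrow> ext" where
  "wedge a b = (\<lambda>U. \<Sum>S\<in>Pow U. ext_sign S (U - S) * a S * b (U - S))"

text \<open>
  The coordinate formula of the derivation, i.e. the linear extension of
  \<open>\<partial> e\<^sub>S = \<Sum>\<^bsub>i \<in> S\<^esub> (-1)\<^bsup>|{j \<in> S. j < i}|\<^esup> e\<^bsub>S - {i}\<^esub>\<close>; the lemmas \<open>ext_bdry_linear\<close>,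
  \<open>ext_bdry_deg\<close>, \<open>ext_bdry_generator\<close> and \<open>ext_bdry_wedge\<close> below show that it is the
  derivation of degree \<open>-1\<close> with \<open>\<partial> e\<^sub>i = 1\<close>.
\<close>

definition ext_bdry :: "nat \<Rightarrow> ext \<Rightarrow> ext" where
  "ext_bdry n a = (\<lambda>T. \<Sum>i\<in>{..n} - T. (-1) ^ card {j\<in>T. j < i} * a (insert i T))"

definition ext_ideal :: "nat \<Rightarrow> ext set \<Rightarrow> bool" where
  "ext_ideal n J \<longleftrightarrow> J \<subseteq> ext_alg n \<and> fun_space.subspace J \<and>
     (\<forall>a\<in>ext_alg n. \<forall>x\<in>J. wedge a x \<in> J \<and> wedge x a \<in> J)"

subsection \<open>The tensor product\<close>

text \<open>
  For subspaces \<open>A\<close>, \<open>B\<close> of the exterior algebra \<open>E\<close>, the tensor product \<open>A \<otimes> B\<close> (over a field)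
  is the span of the pure tensors inside \<open>E \<otimes> E\<close>, whose elements are given by their
  coordinates in the basis \<open>e\<^sub>S \<otimes> e\<^sub>T\<close>.
\<close>

definition ext_tensor :: "ext \<Rightarrow> ext \<Rightarrow> nat set \<times> nat set \<Rightarrow> complex" where
  "ext_tensor a b = (\<lambda>(S, T). a S * b T)"

definition tensor_space :: "ext set \<Rightarrow> ext set \<Rightarrow> (nat set \<times> nat set \<Rightarrow> complex) set" where
  "tensor_space A B = fun_space.span {ext_tensor a b | a b. a \<in> A \<and> b \<in> B}"

text \<open>The linear map with \<open>a \<otimes> b \<mapsto> a \<and> b\<close>; see \<open>wedge_map_tensor\<close> and \<open>wedge_map_linear\<close>.\<close>

definition wedge_map :: "(nat set \<times> nat set \<Rightarrow> complex) \<Rightarrow> ext" where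
  "wedge_map t = (\<lambda>U. \<Sum>S\<in>Pow U. ext_sign S (U - S) * t (S, U - S))"

subsection \<open>The Orlik--Solomon ideal and the Falk invariant\<close>

text \<open>
  \<open>\<alpha> 0, \<dots>, \<alpha> n\<close> are the linear forms, as functions on the ambient space. They are assumed to
  define pairwise distinct hyperplanes, so that linear dependence of the set \<open>\<alpha> ` S\<close>
  is the same as that of the family \<open>\<alpha> i\<close>, \<open>i \<in> S\<close>.
\<close>

definition os_ideal :: "nat \<Rightarrow> (nat \<Rightarrow> 'v \<Rightarrow> complex) \<Rightarrow> ext set" where
  "os_ideal n \<alpha> = ext_ideal n hull
     {ext_bdry n (ext_mono S) | S. S \<subseteq> {..n} \<and> fun_space.dependent (\<alpha> ` S)}"

definition os_ideal_deg :: "nat \<Rightarrow> (nat \<Rightarrow> 'v \<Rightarrow> complex) \<Rightarrow> nat \<Rightarrow> ext set" where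
  "os_ideal_deg n \<alpha> p = os_ideal n \<alpha> \<inter> ext_deg n p"

definition falk_kernel :: "nat \<Rightarrow> (nat \<Rightarrow> 'v \<Rightarrow> complex) \<Rightarrow> (nat set \<times> nat set \<Rightarrow> complex) set" where
  "falk_kernel n \<alpha> = {t \<in> tensor_space (ext_deg n 1) (os_ideal_deg n \<alpha> 2). wedge_map t = 0}"

text \<open>
  The kernel is finite-dimensional by \<open>falk_kernel_finite_dim\<close>, so the convention of
  \<open>dim\<close> for infinite-dimensional spaces is irrelevant here.
\<close>

definition falk_phi3 :: "nat \<Rightarrow> (nat \<Rightarrow> 'v \<Rightarrow> complex) \<Rightarrow> nat" where
  "falk_phi3 n \<alpha> = fun_space.dim (falk_kernel n \<alpha>)"

subsection \<open>Central arrangements in \<open>\<complex>\<^bsup>l + 1\<^esup>\<close>\<close>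

text \<open>Points of \<open>\<complex>\<^bsup>l + 1\<^esup>\<close> are the sequences with coordinates \<open>x\<^sub>0, \<dots>, x\<^sub>l\<close> and \<open>0\<close> afterwards.\<close>

definition cspace :: "nat \<Rightarrow> (nat \<Rightarrow> complex) set" where
  "cspace l = {x. \<forall>k>l. x k = 0}"

text \<open>
  A linear form only looks at the coordinates \<open>x\<^sub>0, \<dots>, x\<^sub>l\<close>, so linear dependence of such functions
  agrees with linear dependence of their restrictions to \<open>cspace l\<close>.
\<close>

definition linear_form :: "nat \<Rightarrow> ((nat \<Rightarrow> complex) \<Rightarrow> complex) \<Rightarrow> bool" where
  "linear_form l f \<longleftrightarrow> (\<exists>c. f = (\<lambda>x. \<Sum>k\<le>l. c k * x k))"

text \<open>
  \<open>\<alpha> 0, \<dots>, \<alpha> n\<close> are linear forms such that the sets \<open>(\<alpha> i)\<^sup>-\<^sup>1(0)\<close> are pairwise distinct and are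
  exactly the members of the arrangement \<open>\<A>\<close>.
\<close>

definition defining_forms ::
  "nat \<Rightarrow> (nat \<Rightarrow> complex) set set \<Rightarrow> nat \<Rightarrow> (nat \<Rightarrow> (nat \<Rightarrow> complex) \<Rightarrow> complex) \<Rightarrow> bool" where
  "defining_forms l \<A> n \<alpha> \<longleftrightarrow>
     (\<forall>i\<le>n. linear_form l (\<alpha> i)) \<and>
     bij_betw (\<lambda>i. {x \<in> cspace l. \<alpha> i x = 0}) {..n} \<A>"

definition cone_linial :: "nat \<Rightarrow> (nat \<Rightarrow> complex) set set" where
  "cone_linial l = insert {x \<in> cspace l. x 0 = 0}
     {{x \<in> cspace l. x i - x j - x 0 = 0} | i j. 1 \<le> i \<and> i < j \<and> j \<le> l}"

subsection \<open>Basic facts supporting the definitions\<close>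

lemma ext_mono_apply: "ext_mono S T = (if T = S then 1 else 0)"
  by (simp add: ext_mono_def)

lemma wedge_map_tensor: "wedge_map (ext_tensor a b) = wedge a b"
  by (simp add: wedge_map_def ext_tensor_def wedge_def mult.assoc)

lemma wedge_map_linear: "Vector_Spaces.linear fscale fscale wedge_map"
  by unfold_locales
    (auto simp: wedge_map_def fun_eq_iff algebra_simps sum.distrib sum_distrib_left)

lemma wedge_add_left: "wedge (a + b) c = wedge a c + wedge b c"
  and wedge_add_right: "wedge c (a + b) = wedge c a + wedge c b"
  and wedge_scale_left: "wedge (fscale r a) c = fscale r (wedge a c)"
  and wedge_scale_right: "wedge c (fscale r a) = fscale r (wedge c a)"
  by (auto simp: wedge_def fun_eq_iff algebra_simps sum.distrib sum_distrib_left)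

lemma wedge_diff_right: "wedge c (a - b) = wedge c a - wedge c b"
  by (auto simp: wedge_def fun_eq_iff algebra_simps sum_subtractf)

lemma ext_bdry_linear: "Vector_Spaces.linear fscale fscale (ext_bdry n)"
  by unfold_locales
    (auto simp: ext_bdry_def fun_eq_iff algebra_simps sum.distrib sum_distrib_left)

lemma ext_sign_Un_left:
  assumes "finite R" "finite Q" "finite P" "R \<inter> Q = {}"
  shows "ext_sign (R \<union> Q) P = ext_sign R P * ext_sign Q P"
proof -
  have eq: "{(i, j). i \<in> R \<union> Q \<and> j \<in> P \<and> j < i} =
      {(i, j). i \<in> R \<and> j \<in> P \<and> j < i} \<union> {(i, j). i \<in> Q \<and> j \<in> P \<and> j < i}" by auto
  have "finite {(i, j). i \<in> R \<and> j \<in> P \<and> j < i}"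
    by (rule finite_subset[of _ "R \<times> P"]) (use assms in auto)
  moreover have "finite {(i, j). i \<in> Q \<and> j \<in> P \<and> j < i}"
    by (rule finite_subset[of _ "Q \<times> P"]) (use assms in auto)
  ultimately show ?thesis unfolding ext_sign_def eq
    by (subst card_Un_disjoint) (use assms in \<open>auto simp: power_add\<close>)
qed

lemma ext_sign_Un_right:
  assumes "finite R" "finite Q" "finite P" "R \<inter> Q = {}"
  shows "ext_sign P (R \<union> Q) = ext_sign P R * ext_sign P Q"
proof -
  have eq: "{(i, j). i \<in> P \<and> j \<in> R \<union> Q \<and> j < i} =
      {(i, j). i \<in> P \<and> j \<in> R \<and> j < i} \<union> {(i, j). i \<in> P \<and> j \<in> Q \<and> j < i}" by auto
  have "finite {(i, j). i \<in> P \<and> j \<in> R \<and> j < i}"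
    by (rule finite_subset[of _ "P \<times> R"]) (use assms in auto)
  moreover have "finite {(i, j). i \<in> P \<and> j \<in> Q \<and> j < i}"
    by (rule finite_subset[of _ "P \<times> Q"]) (use assms in auto)
  ultimately show ?thesis unfolding ext_sign_def eq
    by (subst card_Un_disjoint) (use assms in \<open>auto simp: power_add\<close>)
qed

lemma wedge_assoc: "wedge (wedge a b) c = wedge a (wedge b c)"
proof
  fix U :: "nat set"
  show "wedge (wedge a b) c U = wedge a (wedge b c) U"
  proof (cases "finite U")
    case False
    then show ?thesis by (simp add: wedge_def)
  next
    case True
    have "wedge (wedge a b) c U =
        (\<Sum>(S, R)\<in>Sigma (Pow U) Pow. ext_sign S (U - S) * ext_sign R (S - R) * a R * b (S - R) * c (U - S))"
      using True
      by (subst sum.Sigma[symmetric])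
        (auto simp: wedge_def sum_distrib_left sum_distrib_right mult_ac finite_subset intro!: sum.cong)
    also have "\<dots> = (\<Sum>(R, Q)\<in>Sigma (Pow U) (\<lambda>R. Pow (U - R)).
        ext_sign R (U - R) * ext_sign Q (U - R - Q) * a R * b Q * c (U - R - Q))"
    proof (rule sum.reindex_bij_witness[of _ "\<lambda>(R, Q). (R \<union> Q, R)" "\<lambda>(S, R). (R, S - R)"], goal_cases)
      case (5 p)
      then obtain S R where p: "p = (S, R)" and sub: "R \<subseteq> S" "S \<subseteq> U" by auto
      have fin: "finite R" "finite S" "finite (U - S)" "finite (S - R)"
        using sub True by (auto intro: finite_subset)
      have 1: "ext_sign S (U - S) = ext_sign R (U - S) * ext_sign (S - R) (U - S)"
        using ext_sign_Un_left[of R "S - R" "U - S"] fin sub by (simp add: Un_absorb1)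
      have "U - R = (S - R) \<union> (U - S)" using sub by auto
      then have 2: "ext_sign R (U - R) = ext_sign R (S - R) * ext_sign R (U - S)"
        using ext_sign_Un_right[of "S - R" "U - S" R] fin by auto
      have 3: "U - R - (S - R) = U - S" using sub by auto
      show ?case by (simp add: p 1 2 3)
    qed auto
    also have "\<dots> = wedge a (wedge b c) U"
      using True
      by (subst sum.Sigma[symmetric])
        (auto simp: wedge_def sum_distrib_left sum_distrib_right mult_ac finite_subset intro!: sum.cong)
    finally show ?thesis .
  qed
qed

lemma wedge_generator:
  assumes "finite U"
  shows "wedge (ext_mono {i}) a U =
    (if i \<in> U then (-1) ^ card {j\<in>U. j < i} * a (U - {i}) else 0)"
proof -
  have "wedge (ext_mono {i}) a U =
      (\<Sum>S\<in>Pow U. if S = {i} then ext_sign {i} (U - {i}) * a (U - {i}) else 0)"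
    unfolding wedge_def by (rule sum.cong) (auto simp: ext_mono_apply)
  also have "\<dots> = (if i \<in> U then ext_sign {i} (U - {i}) * a (U - {i}) else 0)"
    using assms by (simp add: sum.delta)
  also have "ext_sign {i} (U - {i}) = (-1) ^ card {j\<in>U. j < i}"
  proof -
    have "{(k, j). k \<in> {i} \<and> j \<in> U - {i} \<and> j < k} = Pair i ` {j\<in>U. j < i}" by auto
    then show ?thesis unfolding ext_sign_def by (simp add: card_image inj_on_def)
  qed
  finally show ?thesis .
qed

lemma wedge_infinite: "infinite U \<Longrightarrow> wedge a b U = 0"
  by (simp add: wedge_def)

lemma ext_alg_infinite: "a \<in> ext_alg n \<Longrightarrow> infinite U \<Longrightarrow> a U = 0"
  using finite_subset[of U "{..n}"] by (auto simp: ext_alg_def)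

lemma wedge_one_left: "a \<in> ext_alg n \<Longrightarrow> wedge (ext_mono {}) a = a"
proof
  fix U assume a: "a \<in> ext_alg n"
  show "wedge (ext_mono {}) a U = a U"
  proof (cases "finite U")
    case False then show ?thesis using ext_alg_infinite[OF a] by (simp add: wedge_infinite)
  next
    case True
    have "wedge (ext_mono {}) a U = (\<Sum>S\<in>Pow U. if S = {} then a U else 0)"
      unfolding wedge_def by (rule sum.cong) (auto simp: ext_mono_apply ext_sign_def)
    then show ?thesis using True by (simp add: sum.delta)
  qed
qed

lemma wedge_generator_self: "wedge (ext_mono {i}) (ext_mono {i}) = 0"
proof
  fix U show "wedge (ext_mono {i}) (ext_mono {i}) U = 0 U"
    by (cases "finite U") (auto simp: wedge_generator wedge_infinite ext_mono_apply)
qed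

lemma wedge_generator_anticommute:
  "wedge (ext_mono {i}) (ext_mono {j}) = - wedge (ext_mono {j}) (ext_mono {i})"
proof (cases "i = j")
  case False
  show ?thesis
  proof
    fix U
    show "wedge (ext_mono {i}) (ext_mono {j}) U = (- wedge (ext_mono {j}) (ext_mono {i})) U"
    proof (cases "U = {i, j}")
      case True
      have 1: "{k\<in>{i, j}. k < i} = (if j < i then {j} else {})"
        "{k\<in>{i, j}. k < j} = (if i < j then {i} else {})" by auto
      have 2: "{i, j} - {i} = {j}" "{i, j} - {j} = {i}" using False by auto
      have 3: "card {k\<in>{i, j}. k < i} = (if j < i then 1 else 0)"
        "card {k\<in>{i, j}. k < j} = (if i < j then 1 else 0)" unfolding 1 by auto
      have fin: "finite {i, j}" by simp
      show ?thesis using False unfolding True uminus_apply wedge_generator[OF fin] 2 3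
        by (simp add: ext_mono_apply)
    next
      case neq: False
      have "\<not> (i \<in> U \<and> U - {i} = {j})" "\<not> (j \<in> U \<and> U - {j} = {i})" using neq by auto
      then show ?thesis
        by (cases "finite U") (auto simp: wedge_generator wedge_infinite ext_mono_apply)
    qed
  qed
qed (simp add: wedge_generator_self)

lemma ext_mono_insert:
  assumes "finite S" "\<And>j. j \<in> S \<Longrightarrow> i < j"
  shows "ext_mono (insert i S) = wedge (ext_mono {i}) (ext_mono S)"
proof
  fix U
  have i: "i \<notin> S" using assms(2) by blast
  show "ext_mono (insert i S) U = wedge (ext_mono {i}) (ext_mono S) U"
  proof (cases "U = insert i S")
    case True
    have 1: "{j \<in> insert i S. j < i} = {}" using assms(2) by (auto dest: less_asym)
    have 2: "insert i S - {i} = S" using i by simp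
    have 3: "finite (insert i S)" using assms by simp
    show ?thesis unfolding True wedge_generator[OF 3] 1 2 by (simp add: ext_mono_apply)
  next
    case False
    then have "\<not> (i \<in> U \<and> U - {i} = S)" by auto
    then show ?thesis using False
      by (cases "finite U") (auto simp: wedge_generator wedge_infinite ext_mono_apply)
  qed
qed

lemma ext_bdry_one: "ext_bdry n (ext_mono {}) = 0"
  by (auto simp: ext_bdry_def ext_mono_apply fun_eq_iff)

lemma ext_bdry_generator:
  assumes "i \<le> n"
  shows "ext_bdry n (ext_mono {i}) = ext_mono {}"
proof
  fix T
  show "ext_bdry n (ext_mono {i}) T = ext_mono {} T"
  proof (cases "T = {}")
    case True
    have "ext_bdry n (ext_mono {i}) T = (\<Sum>k\<le>n. if k = i then 1 else 0)"
      unfolding ext_bdry_def True by (rule sum.cong) (auto simp: ext_mono_apply)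
    then show ?thesis using assms True by (simp add: ext_mono_apply)
  next
    case False
    then have "ext_mono {i} (insert k T) = 0" if "k \<notin> T" for k
      using that by (auto simp: ext_mono_apply)
    then show ?thesis using False by (auto simp: ext_bdry_def ext_mono_apply[of "{}"] intro!: sum.neutral)
  qed
qed

lemma ext_bdry_deg: "a \<in> ext_deg n (Suc p) \<Longrightarrow> ext_bdry n a \<in> ext_deg n p"
proof -
  assume a: "a \<in> ext_deg n (Suc p)"
  have "T \<subseteq> {..n} \<and> card T = p" if nz: "ext_bdry n a T \<noteq> 0" for T
  proof -
    obtain i where i: "i \<in> {..n} - T" "a (insert i T) \<noteq> 0"
      using nz unfolding ext_bdry_def by (rule sum.not_neutral_contains_not_neutral) auto
    then have "insert i T \<subseteq> {..n}" "card (insert i T) = Suc p" using a by (auto simp: ext_deg_def)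
    moreover from this have "finite T" by (auto intro: finite_subset)
    ultimately show ?thesis using i by auto
  qed
  then show ?thesis by (auto simp: ext_deg_def)
qed

lemma ext_bdry_infinite: "a \<in> ext_alg n \<Longrightarrow> infinite T \<Longrightarrow> ext_bdry n a T = 0"
  using ext_alg_infinite[of a n] by (auto simp: ext_bdry_def)

lemma wedge_in_ext_alg: "a \<in> ext_alg n \<Longrightarrow> b \<in> ext_alg n \<Longrightarrow> wedge a b \<in> ext_alg n"
proof -
  assume ab: "a \<in> ext_alg n" "b \<in> ext_alg n"
  have "U \<subseteq> {..n}" if nz: "wedge a b U \<noteq> 0" for U
  proof -
    obtain S where "S \<in> Pow U" "a S \<noteq> 0" "b (U - S) \<noteq> 0"
      using nz unfolding wedge_def by (rule sum.not_neutral_contains_not_neutral) auto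
    then have "S \<subseteq> {..n}" "U - S \<subseteq> {..n}" using ab by (auto simp: ext_alg_def)
    then show ?thesis by blast
  qed
  then show ?thesis by (auto simp: ext_alg_def)
qed

lemma ext_mono_in_ext_alg: "S \<subseteq> {..n} \<Longrightarrow> ext_mono S \<in> ext_alg n"
  by (auto simp: ext_alg_def ext_mono_apply)

lemma ext_bdry_in_ext_alg: "a \<in> ext_alg n \<Longrightarrow> ext_bdry n a \<in> ext_alg n"
proof -
  assume a: "a \<in> ext_alg n"
  have "T \<subseteq> {..n}" if nz: "ext_bdry n a T \<noteq> 0" for T
  proof -
    obtain i where "i \<in> {..n} - T" "a (insert i T) \<noteq> 0"
      using nz unfolding ext_bdry_def by (rule sum.not_neutral_contains_not_neutral) auto
    then show ?thesis using a by (auto simp: ext_alg_def)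
  qed
  then show ?thesis by (auto simp: ext_alg_def)
qed

lemma ext_bdry_wedge_generator:
  assumes "i \<le> n" "a \<in> ext_alg n"
  shows "ext_bdry n (wedge (ext_mono {i}) a) = a - wedge (ext_mono {i}) (ext_bdry n a)"
proof
  fix T
  define f where "f k S = (-1 :: complex) ^ card {j\<in>S. j < k}" for k :: nat and S :: "nat set"
  have f2: "f k S * f k S = 1" for k S by (simp add: f_def flip: power_add)
  show "ext_bdry n (wedge (ext_mono {i}) a) T = (a - wedge (ext_mono {i}) (ext_bdry n a)) T"
  proof (cases "finite T")
    case False
    have m: "ext_mono {i} \<in> ext_alg n" using assms by (simp add: ext_mono_in_ext_alg)
    show ?thesis using False assms(2) m
      by (simp add: ext_bdry_infinite ext_alg_infinite wedge_infinite wedge_in_ext_alg)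
  next
    case fin: True
    have L: "ext_bdry n (wedge (ext_mono {i}) a) T = (\<Sum>k\<in>{..n} - T. f k T *
        (if i \<in> insert k T then f i (insert k T) * a (insert k T - {i}) else 0))"
      using fin by (simp add: ext_bdry_def wedge_generator f_def cong: if_cong)
    show ?thesis
    proof (cases "i \<in> T")
      case False
      have "ext_bdry n (wedge (ext_mono {i}) a) T = (\<Sum>k\<in>{..n} - T. if k = i then a T else 0)"
        unfolding L
      proof (rule sum.cong)
        fix k assume k: "k \<in> {..n} - T"
        have "{j \<in> insert i T. j < i} = {j \<in> T. j < i}" by auto
        then have "f i (insert i T) = f i T" by (simp add: f_def)
        then show "f k T * (if i \<in> insert k T then f i (insert k T) * a (insert k T - {i}) else 0)
            = (if k = i then a T else 0)"
          using False k f2[of i T] by (auto simp: mult.assoc[symmetric])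
      qed simp
      also have "\<dots> = a T" using False assms by (simp add: sum.delta)
      finally show ?thesis using False fin by (simp add: wedge_generator)
    next
      case True
      let ?T = "T - {i}"
      have R: "wedge (ext_mono {i}) (ext_bdry n a) T =
          f i T * (\<Sum>k\<in>{..n} - ?T. f k ?T * a (insert k ?T))"
        using fin True by (simp add: wedge_generator ext_bdry_def f_def)
      have split: "{..n} - ?T = insert i ({..n} - T)" using True assms by auto
      have "(\<Sum>k\<in>{..n} - ?T. f k ?T * a (insert k ?T)) =
          f i ?T * a T + (\<Sum>k\<in>{..n} - T. f k ?T * a (insert k ?T))"
        unfolding split using True by (subst sum.insert) (auto simp: insert_absorb)
      moreover have "f i ?T = f i T"
      proof -
        have "{j \<in> ?T. j < i} = {j \<in> T. j < i}" by auto
        then show ?thesis by (simp add: f_def)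
      qed
      ultimately have R': "wedge (ext_mono {i}) (ext_bdry n a) T =
          a T + (\<Sum>k\<in>{..n} - T. f i T * (f k ?T * a (insert k ?T)))"
        unfolding R using f2[of i T]
        by (simp add: distrib_left mult.assoc[symmetric] sum_distrib_left)
      have "ext_bdry n (wedge (ext_mono {i}) a) T =
          (\<Sum>k\<in>{..n} - T. - (f i T * (f k ?T * a (insert k ?T))))"
        unfolding L
      proof (rule sum.cong)
        fix k assume k: "k \<in> {..n} - T"
        then have ki: "k \<noteq> i" using True by auto
        have sets: "insert k T - {i} = insert k ?T" using ki by auto
        have sign: "f k T * f i (insert k T) = - (f i T * f k ?T)"
        proof (cases "k < i")
          case True
          have 1: "{j \<in> insert k T. j < i} = insert k {j \<in> T. j < i}" using True by auto
          have 2: "{j \<in> ?T. j < k} = {j \<in> T. j < k}" using True by auto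
          have "f i (insert k T) = - f i T"
            using k fin unfolding f_def 1 by (subst card_insert_disjoint) auto
          then show ?thesis unfolding f_def 2 by simp
        next
          case False
          then have ik: "i < k" using ki by simp
          have 1: "{j \<in> insert k T. j < i} = {j \<in> T. j < i}" using ik by auto
          have 2: "{j \<in> T. j < k} = insert i {j \<in> ?T. j < k}" using ik \<open>i \<in> T\<close> by auto
          have "f k T = - f k ?T"
            using fin unfolding f_def 2 by (subst card_insert_disjoint) auto
          then show ?thesis unfolding f_def 1 by simp
        qed
        have "f k T * (f i (insert k T) * a (insert k T - {i})) =
            (f k T * f i (insert k T)) * a (insert k ?T)"
          by (simp add: sets)
        also have "\<dots> = - (f i T * (f k ?T * a (insert k ?T)))"
          unfolding sign by simp
        finally show "f k T * (if i \<in> insert k T then f i (insert k T) * a (insert k T - {i}) else 0)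
            = - (f i T * (f k ?T * a (insert k ?T)))"
          using True by simp
      qed simp
      then show ?thesis by (simp add: R' sum_negf)
    qed
  qed
qed

lemma ext_bdry_wedge_mono:
  assumes "S \<subseteq> {..n}" "b \<in> ext_alg n"
  shows "ext_bdry n (wedge (ext_mono S) b) =
    wedge (ext_bdry n (ext_mono S)) b + fscale ((-1) ^ card S) (wedge (ext_mono S) (ext_bdry n b))"
proof -
  have "finite S" using assms by (auto intro: finite_subset)
  then show ?thesis using assms(1)
  proof (induction S rule: finite_linorder_min_induct)
    case empty
    have 0: "wedge 0 b = 0" by (auto simp: wedge_def fun_eq_iff)
    show ?case
      unfolding ext_bdry_one 0 wedge_one_left[OF assms(2)]
        wedge_one_left[OF ext_bdry_in_ext_alg[OF assms(2)]]
      by (simp add: fun_eq_iff)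
  next
    case (insert i S)
    let ?i = "ext_mono {i}" and ?S = "ext_mono S"
    have S: "S \<subseteq> {..n}" "i \<le> n" "i \<notin> S" using insert by auto
    have mem: "?S \<in> ext_alg n" "wedge ?S b \<in> ext_alg n"
      using S assms(2) by (auto intro: ext_mono_in_ext_alg wedge_in_ext_alg)
    have eq: "ext_mono (insert i S) = wedge ?i ?S"
      using insert by (intro ext_mono_insert) auto
    have "ext_bdry n (wedge (wedge ?i ?S) b) = wedge ?S b - wedge ?i (ext_bdry n (wedge ?S b))"
      using S mem by (simp add: wedge_assoc ext_bdry_wedge_generator)
    also have "\<dots> = wedge ?S b - wedge ?i (wedge (ext_bdry n ?S) b)
        - fscale ((-1) ^ card S) (wedge ?i (wedge ?S (ext_bdry n b)))"
      unfolding insert.IH[OF S(1)] wedge_add_right wedge_scale_right by (simp only: diff_diff_eq)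
    also have "\<dots> = wedge (?S - wedge ?i (ext_bdry n ?S)) b
        + fscale ((-1) ^ Suc (card S)) (wedge (wedge ?i ?S) (ext_bdry n b))"
      by (simp add: wedge_assoc[symmetric])
        (auto simp: wedge_def fun_eq_iff algebra_simps sum_subtractf)
    also have "?S - wedge ?i (ext_bdry n ?S) = ext_bdry n (wedge ?i ?S)"
      using S mem by (simp add: ext_bdry_wedge_generator)
    finally show ?case using insert.hyps S by (simp add: eq)
  qed
qed

lemma ext_deg_expand:
  assumes "a \<in> ext_deg n p"
  shows "a = (\<Sum>S | S \<subseteq> {..n} \<and> card S = p. fscale (a S) (ext_mono S))"
proof
  fix U
  have fin: "finite {S. S \<subseteq> {..n} \<and> card S = p}"
    by (rule finite_subset[of _ "Pow {..n}"]) auto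
  have "(\<Sum>S | S \<subseteq> {..n} \<and> card S = p. fscale (a S) (ext_mono S) U) =
      (\<Sum>S | S \<subseteq> {..n} \<and> card S = p. if S = U then a U else 0)"
    by (rule sum.cong) (auto simp: ext_mono_apply)
  also have "\<dots> = a U" using assms fin by (auto simp: ext_deg_def)
  finally show "a U = (\<Sum>S | S \<subseteq> {..n} \<and> card S = p. fscale (a S) (ext_mono S)) U"
    by (simp add: sum_fun_apply)
qed

lemma ext_bdry_wedge:
  assumes "a \<in> ext_deg n p" "b \<in> ext_alg n"
  shows "ext_bdry n (wedge a b) =
    wedge (ext_bdry n a) b + fscale ((-1) ^ p) (wedge a (ext_bdry n b))"
proof -
  interpret B: Vector_Spaces.linear fscale fscale "ext_bdry n" by (rule ext_bdry_linear)
  define D where "D x = ext_bdry n (wedge x b) -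
    (wedge (ext_bdry n x) b + fscale ((-1) ^ p) (wedge x (ext_bdry n b)))" for x
  interpret D: Vector_Spaces.linear fscale fscale D
    by unfold_locales
      (simp_all add: D_def wedge_add_left wedge_scale_left B.add B.scale
        fun_space.scale_right_distrib fun_space.scale_right_diff_distrib mult.commute)
  have "D a = (\<Sum>S | S \<subseteq> {..n} \<and> card S = p. D (fscale (a S) (ext_mono S)))"
    using arg_cong[OF ext_deg_expand[OF assms(1)], of D] by (simp only: D.sum)
  also have "\<dots> = 0"
  proof (intro sum.neutral ballI)
    fix S assume "S \<in> {S. S \<subseteq> {..n} \<and> card S = p}"
    then have "D (ext_mono S) = 0"
      using ext_bdry_wedge_mono[OF _ assms(2)] by (auto simp: D_def)
    then show "D (fscale (a S) (ext_mono S)) = 0" by (simp only: D.scale fun_space.scale_zero_right)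
  qed
  finally show ?thesis by (simp add: D_def)
qed

lemma falk_kernel_finite_dim:
  "\<exists>B. finite B \<and> falk_kernel n \<alpha> \<subseteq> fun_space.span B"
proof -
  define B where "B = (\<lambda>(S, T). ext_tensor (ext_mono S) (ext_mono T)) ` (Pow {..n} \<times> Pow {..n})"
  have "ext_tensor a b \<in> fun_space.span B" if "a \<in> ext_deg n 1" "b \<in> ext_deg n 2" for a b
  proof -
    have "ext_tensor a b =
        (\<Sum>p\<in>Pow {..n} \<times> Pow {..n}. fscale (a (fst p) * b (snd p))
          (ext_tensor (ext_mono (fst p)) (ext_mono (snd p))))"
    proof
      fix q :: "nat set \<times> nat set"
      have "(\<Sum>p\<in>Pow {..n} \<times> Pow {..n}. fscale (a (fst p) * b (snd p))
          (ext_tensor (ext_mono (fst p)) (ext_mono (snd p))) q) =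
          (\<Sum>p\<in>Pow {..n} \<times> Pow {..n}. if p = q then a (fst q) * b (snd q) else 0)"
        by (rule sum.cong) (auto simp: ext_tensor_def ext_mono_apply split: prod.splits)
      also have "\<dots> = ext_tensor a b q"
        using that by (cases q) (auto simp: ext_tensor_def ext_deg_def)
      finally show "ext_tensor a b q = (\<Sum>p\<in>Pow {..n} \<times> Pow {..n}. fscale (a (fst p) * b (snd p))
          (ext_tensor (ext_mono (fst p)) (ext_mono (snd p)))) q"
        by (simp add: sum_fun_apply)
    qed
    also have "\<dots> \<in> fun_space.span B"
      by (intro fun_space.span_sum fun_space.span_scale fun_space.span_base) (auto simp: B_def)
    finally show ?thesis .
  qed
  then have "{ext_tensor a b | a b. a \<in> ext_deg n 1 \<and> b \<in> os_ideal_deg n \<alpha> 2} \<subseteq> fun_space.span B"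
    by (auto simp: os_ideal_deg_def)
  then have "tensor_space (ext_deg n 1) (os_ideal_deg n \<alpha> 2) \<subseteq> fun_space.span B"
    unfolding tensor_space_def by (rule fun_space.span_minimal) simp
  moreover have "finite B" by (simp add: B_def)
  ultimately show ?thesis by (auto simp: falk_kernel_def)
qed

lemma cone_linial_defining_forms: "\<exists>n \<alpha>. defining_forms l (cone_linial l) n \<alpha>"
proof -
  have lf0: "linear_form l (\<lambda>x. x 0)"
    unfolding linear_form_def
    by (rule exI[of _ "\<lambda>k. if k = 0 then 1 else 0"]) (simp add: if_distrib[of "\<lambda>c. c * _"] cong: if_cong)
  have lf: "linear_form l (\<lambda>x. x i - x j - x 0)" if "i \<le> l" "j \<le> l" for i j
    unfolding linear_form_def
    by (rule exI[of _ "\<lambda>k. (if k = i then 1 else 0) - (if k = j then 1 else 0) - (if k = 0 then 1 else 0)"])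
      (use that in \<open>simp add: left_diff_distrib sum_subtractf if_distrib[of "\<lambda>c. c * _"] cong: if_cong\<close>)
  have "cone_linial l \<subseteq> insert {x \<in> cspace l. x 0 = 0}
      ((\<lambda>(i, j). {x \<in> cspace l. x i - x j - x 0 = 0}) ` ({..l} \<times> {..l}))"
    by (auto simp: cone_linial_def image_iff)
  then have fin: "finite (cone_linial l)" by (rule finite_subset) auto
  obtain h where h: "bij_betw h {..<card (cone_linial l)} (cone_linial l)"
    using ex_bij_betw_nat_finite[OF fin] by (auto simp: atLeast0LessThan)
  have "cone_linial l \<noteq> {}" by (simp add: cone_linial_def)
  then obtain n where n: "card (cone_linial l) = Suc n"
    using fin by (metis card_eq_0_iff not0_implies_Suc)
  have h': "bij_betw h {..n} (cone_linial l)" using h unfolding n by (simp add: lessThan_Suc_atMost)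
  have ex: "\<exists>f. linear_form l f \<and> H = {x \<in> cspace l. f x = 0}" if H: "H \<in> cone_linial l" for H
  proof -
    consider "H = {x \<in> cspace l. x 0 = 0}"
      | i j where "H = {x \<in> cspace l. x i - x j - x 0 = 0}" "i < j" "j \<le> l"
      using H unfolding cone_linial_def by blast
    then show ?thesis
    proof cases
      case 1
      then show ?thesis using lf0 by (intro exI[of _ "\<lambda>x. x 0"]) auto
    next
      case (2 i j)
      then show ?thesis using lf[of i j] by (intro exI[of _ "\<lambda>x. x i - x j - x 0"]) auto
    qed
  qed
  define \<alpha> where "\<alpha> i = (SOME f. linear_form l f \<and> h i = {x \<in> cspace l. f x = 0})" for i
  have \<alpha>: "linear_form l (\<alpha> i)" "h i = {x \<in> cspace l. \<alpha> i x = 0}" if "i \<le> n" for i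
  proof -
    have "h i \<in> cone_linial l" using h' that by (auto simp: bij_betw_def)
    from someI_ex[OF ex[OF this]] show "linear_form l (\<alpha> i)" "h i = {x \<in> cspace l. \<alpha> i x = 0}"
      by (auto simp: \<alpha>_def)
  qed
  have "bij_betw (\<lambda>i. {x \<in> cspace l. \<alpha> i x = 0}) {..n} (cone_linial l)"
    using h' \<alpha>(2) by (subst bij_betw_cong[of _ _ h]) auto
  then have "defining_forms l (cone_linial l) n \<alpha>"
    using \<alpha>(1) by (simp add: defining_forms_def)
  then show ?thesis by blast
qed

end

theory Submission
  imports Defs
begin

text \<open>
  No three hyperplanes of the cone of the Linial arrangement have linearly dependent normals:
  three edges of a forest are independent, a triangle \<open>i < j < k\<close> satisfies
  \<open>\<alpha>\<^bsub>ij\<^esub> + \<alpha>\<^bsub>jk\<^esub> - \<alpha>\<^bsub>ik\<^esub> = -x\<^sub>0 \<noteq> 0\<close>, and no two hyperplanes other than \<open>x\<^sub>0 = 0\<close> are parallel in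
  the affine chart \<open>x\<^sub>0 = 1\<close>. Hence the Orlik--Solomon ideal is generated in degrees at least
  \<open>3\<close>, so \<open>I\<^sup>2 = 0\<close> and the kernel is trivial.
\<close>

section \<open>Degree bounds in the Orlik-Solomon ideal\<close>

text \<open>A nonzero coordinate of a wedge at \<open>U\<close> comes from a splitting of
  \<open>U\<close> into \<open>S\<close> and \<open>U - S\<close>, so \<open>card U\<close> is at
  least the size of either piece.\<close>

lemma ext_ideal_card_ge: "ext_ideal n {a \<in> ext_alg n. \<forall>S. a S \<noteq> 0 \<longrightarrow> d \<le> card S}"
  (is "ext_ideal n ?J")
proof -
  \<comment> \<open>Membership in \<open>ext_alg n\<close> keeps \<open>U\<close> finite; an
    infinite \<open>U\<close> would have cardinality \<open>0\<close>.\<close>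
  have card_mono': "card S \<le> card U" if "a U \<noteq> 0" "a \<in> ext_alg n" "S \<subseteq> U" for a :: ext and S U
  proof -
    have "U \<subseteq> {..n}" using that by (auto simp: ext_alg_def)
    then show ?thesis using that(3) by (meson card_mono finite_atMost finite_subset)
  qed
  have "d \<le> card U"
    if "wedge a b U \<noteq> 0" "a \<in> ext_alg n" "b \<in> ext_alg n"
      "(\<forall>S. a S \<noteq> 0 \<longrightarrow> d \<le> card S) \<or> (\<forall>S. b S \<noteq> 0 \<longrightarrow> d \<le> card S)" for a b U
  proof -
    have "\<exists>S\<in>Pow U. ext_sign S (U - S) * a S * b (U - S) \<noteq> 0"
    proof (rule ccontr)
      assume "\<not> ?thesis"
      then have "wedge a b U = 0" unfolding wedge_def by (intro sum.neutral) simp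
      with that(1) show False by contradiction
    qed
    then obtain S where S: "S \<in> Pow U" "ext_sign S (U - S) * a S * b (U - S) \<noteq> 0" ..
    then have nz: "a S \<noteq> 0" "b (U - S) \<noteq> 0" by auto
    have "card S \<le> card U" "card (U - S) \<le> card U"
      using card_mono'[OF that(1) wedge_in_ext_alg[OF that(2,3)]] S(1) by auto
    then show ?thesis using that(4) nz by (meson le_trans)
  qed
  moreover have "fun_space.subspace ?J"
  proof (rule fun_space.subspaceI)
    fix a b assume "a \<in> ?J" "b \<in> ?J"
    moreover have "a S \<noteq> 0 \<or> b S \<noteq> 0" if "(a + b) S \<noteq> 0" for S using that by auto
    ultimately show "a + b \<in> ?J" unfolding ext_alg_def by blast
  qed (auto simp: ext_alg_def)
  ultimately show ?thesis by (auto simp: ext_ideal_def wedge_in_ext_alg)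
qed

lemma ext_bdry_mono_card:
  assumes "S \<subseteq> {..n}" "ext_bdry n (ext_mono S) T \<noteq> 0"
  shows "Suc (card T) = card S"
proof -
  obtain i where "i \<in> {..n} - T" "ext_mono S (insert i T) \<noteq> 0"
    using assms(2) unfolding ext_bdry_def by (rule sum.not_neutral_contains_not_neutral) auto
  then have "S = insert i T" "i \<notin> T" by (auto simp: ext_mono_apply split: if_splits)
  moreover have "finite S" using assms(1) finite_subset by blast
  ultimately show ?thesis by auto
qed

text \<open>A dependent \<open>S\<close> has at least \<open>p + 2\<close> elements and the boundary
  lowers degree by one, so all generators lie in the ideal of elements supported in degrees at least
  \<open>p + 1\<close>.\<close>

lemma os_ideal_deg_eq_0:
  assumes indep: "\<And>S. S \<subseteq> {..n} \<Longrightarrow> card S \<le> Suc p \<Longrightarrow> \<not> fun_space.dependent (\<alpha> ` S)"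
  shows "os_ideal_deg n \<alpha> p \<subseteq> {0}"
proof -
  let ?J = "{a \<in> ext_alg n. \<forall>S. a S \<noteq> 0 \<longrightarrow> Suc p \<le> card S}"
  have "os_ideal n \<alpha> \<subseteq> ?J"
    unfolding os_ideal_def
  proof (rule hull_minimal[where S = "ext_ideal n", OF _ ext_ideal_card_ge], safe)
    fix S T assume S: "S \<subseteq> {..n}" "fun_space.dependent (\<alpha> ` S)"
    show "ext_bdry n (ext_mono S) \<in> ext_alg n"
      using S by (intro ext_bdry_in_ext_alg ext_mono_in_ext_alg)
    assume "ext_bdry n (ext_mono S) T \<noteq> 0"
    then show "Suc p \<le> card T"
      using ext_bdry_mono_card[OF S(1)] indep[OF S(1)] S(2) by force
  qed
  moreover have "a = 0" if "a \<in> ?J" "a \<in> ext_deg n p" for a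
  proof
    fix S show "a S = 0 S" using that by (auto simp: ext_deg_def dest!: spec[of _ S])
  qed
  ultimately show ?thesis by (auto simp: os_ideal_deg_def)
qed

text \<open>All pure tensors vanish, so the kernel lies in the span of the empty set, whose
  cardinality bounds the dimension.\<close>

lemma falk_phi3_eq_0:
  assumes "os_ideal_deg n \<alpha> 2 \<subseteq> {0}"
  shows "falk_phi3 n \<alpha> = 0"
proof -
  have "{ext_tensor a b | a b. a \<in> ext_deg n 1 \<and> b \<in> os_ideal_deg n \<alpha> 2} \<subseteq> {0}"
    using assms by (auto simp: ext_tensor_def fun_eq_iff)
  then have "tensor_space (ext_deg n 1) (os_ideal_deg n \<alpha> 2) \<subseteq> fun_space.span {0}"
    unfolding tensor_space_def by (rule fun_space.span_mono)
  then have "falk_kernel n \<alpha> \<subseteq> {0}" by (auto simp: falk_kernel_def)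
  then have "falk_kernel n \<alpha> \<subseteq> fun_space.span {}" by simp
  from fun_space.dim_le_card[OF this] show ?thesis by (simp add: falk_phi3_def)
qed

section \<open>Independence from separating points\<close>

text \<open>Evaluating a vanishing combination at the point \<open>x\<close> chosen for
  \<open>f\<close> kills every term but \<open>u f * f x\<close>, so \<open>u f = 0\<close>.\<close>

lemma independent_if_separated:
  fixes S :: "('a \<Rightarrow> complex) set"
  assumes "finite S" "\<And>f. f \<in> S \<Longrightarrow> \<exists>x. f x \<noteq> 0 \<and> (\<forall>g\<in>S - {f}. g x = 0)"
  shows "\<not> fun_space.dependent S"
proof
  assume "fun_space.dependent S"
  then obtain u f where f: "f \<in> S" "u f \<noteq> 0" and 0: "(\<Sum>g\<in>S. fscale (u g) g) = 0"
    using fun_space.dependent_finite[OF assms(1)] by auto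
  obtain x where x: "f x \<noteq> 0" "\<forall>g\<in>S - {f}. g x = 0" using assms(2)[OF f(1)] by blast
  have "0 = (\<Sum>g\<in>S. u g * g x)" using fun_cong[OF 0, of x] by (simp add: sum_fun_apply)
  also have "\<dots> = u f * f x + (\<Sum>g\<in>S - {f}. u g * g x)"
    using assms(1) f(1) by (rule sum.remove)
  also have "\<dots> = u f * f x" using x(2) by (simp add: sum.neutral)
  finally show False using f(2) x(1) by simp
qed

section \<open>Points on the hyperplanes of the cone\<close>

lemma cone_linial_cases:
  assumes "H \<in> cone_linial l"
  obtains (infinity) "H = {x \<in> cspace l. x 0 = 0}"
  | (affine) i j where "H = {x \<in> cspace l. x i - x j - x 0 = 0}" "1 \<le> i" "i < j" "j \<le> l"
  using assms unfolding cone_linial_def by blast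

text \<open>Serves the one-element families, where there is no other hyperplane to lie on.\<close>

lemma cone_linial_proper:
  assumes "H \<in> cone_linial l"
  shows "\<exists>x \<in> cspace l. x \<notin> H"
  using assms
proof (cases rule: cone_linial_cases)
  case infinity
  then show ?thesis by (intro bexI[of _ "\<lambda>m. if m = 0 then 1 else 0"]) (auto simp: cspace_def)
next
  case (affine i j)
  then show ?thesis by (intro bexI[of _ "\<lambda>m. if m = i then 1 else 0"]) (auto simp: cspace_def)
qed

text \<open>Along a chain of two edges the coordinates descend as 2, 1, 0; otherwise neither
  \<open>j\<close> nor \<open>q\<close> is in \<open>{i, p}\<close>, and the indicator of the
  smaller endpoints works, with \<open>x 0 = 1\<close> in all cases.\<close>

lemma affine_pair_point:
  fixes i j p q :: nat
  assumes "1 \<le> i" "i < j" "1 \<le> p" "p < q" "j \<le> l" "q \<le> l"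
  shows "\<exists>x \<in> cspace l. x 0 = 1 \<and> x i - x j = 1 \<and> x p - x q = 1"
proof -
  define x :: "nat \<Rightarrow> complex" where
    "x = (if j = p then (\<lambda>m. if m = i then 2 else if m = j \<or> m = 0 then 1 else 0)
      else if q = i then (\<lambda>m. if m = p then 2 else if m = q \<or> m = 0 then 1 else 0)
      else (\<lambda>m. if m = i \<or> m = p \<or> m = 0 then 1 else 0))"
  have "x \<in> cspace l \<and> x 0 = 1 \<and> x i - x j = 1 \<and> x p - x q = 1"
    using assms by (auto simp: x_def cspace_def)
  then show ?thesis by blast
qed

text \<open>
  If the edges \<open>km\<close> and \<open>pq\<close> do not connect \<open>i\<close> with \<open>j\<close>, the indicator function of a union of
  components separates; otherwise the three edges form a triangle with apex \<open>a\<close>, where the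
  parity of \<open>x i - x j\<close> is the obstruction.
\<close>

lemma affine_triple_point:
  fixes i j k m p q :: nat
  assumes ij: "1 \<le> i" "i < j" "j \<le> l" and km: "1 \<le> k" "k < m" "m \<le> l"
    and pq: "1 \<le> p" "p < q" "q \<le> l" and ne: "(k, m) \<noteq> (i, j)" "(p, q) \<noteq> (i, j)"
  shows "\<exists>x \<in> cspace l. x k - x m = x 0 \<and> x p - x q = x 0 \<and> x i - x j \<noteq> x 0"
proof -
  \<comment> \<open>As \<open>A\<close> avoids \<open>0\<close>, the indicator has
    \<open>x 0 = 0\<close>, so each condition only compares its values at two ends of an
    edge.\<close>
  have ind: ?thesis
    if "A \<subseteq> {1..l}" "k \<in> A \<longleftrightarrow> m \<in> A" "p \<in> A \<longleftrightarrow> q \<in> A" "i \<in> A \<longleftrightarrow> j \<notin> A" for A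
    by (rule bexI[of _ "\<lambda>v. if v \<in> A then 1 else 0"]) (use that in \<open>auto simp: cspace_def\<close>)
  have apex: ?thesis if "a \<in> {k, m}" "a \<in> {p, q}" "{i, j} \<subseteq> {k, m, p, q}" "a \<notin> {i, j}" for a
  proof -
    obtain x where x: "x \<in> cspace l" "x 0 = 1" "x k - x m = 1" "x p - x q = 1"
      using affine_pair_point[of k m p q l] km pq by blast
    have "{i, j} = {k, p} \<and> a = m \<and> a = q \<or> {i, j} = {k, q} \<and> a = m \<and> a = p \<or>
        {i, j} = {m, p} \<and> a = k \<and> a = q \<or> {i, j} = {m, q} \<and> a = k \<and> a = p"
      using that ij by (auto simp: doubleton_eq_iff)
    moreover have "x k = x m + 1" "x p = x q + 1"
      using x(3,4) by (simp_all add: diff_eq_eq add.commute)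
    \<comment> \<open>Both \<open>i\<close> and \<open>j\<close> are joined to \<open>a\<close> by
      an edge, so their values differ from \<open>x a\<close> by \<open>1\<close> or
      \<open>-1\<close>.\<close>
    ultimately have d: "x i - x j \<in> {0, 2, -2}"
      by (auto simp: doubleton_eq_iff)
    have "x i - x j \<noteq> 1"
    proof
      assume "x i - x j = 1"
      with d show False by (simp add: complex_eq_iff)
    qed
    with x show ?thesis by (intro bexI[of _ x]) auto
  qed
  \<comment> \<open>Edges are increasing pairs, so one containing both \<open>i\<close> and
    \<open>j\<close> would equal \<open>(i, j)\<close>.\<close>
  have distinct: "\<not> (i \<in> {k, m} \<and> j \<in> {k, m})" "\<not> (i \<in> {p, q} \<and> j \<in> {p, q})"
    using ij km pq ne by auto
  from distinct consider "i \<notin> {k, m, p, q}" | "j \<notin> {k, m, p, q}"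
    | "i \<in> {k, m}" "j \<in> {p, q}" | "j \<in> {k, m}" "i \<in> {p, q}"
    unfolding insert_iff empty_iff by argo
  then show ?thesis
  proof cases
    case 1
    then show ?thesis using ij by (intro ind[of "{i}"]) auto
  next
    case 2
    then show ?thesis using ij by (intro ind[of "{j}"]) auto
  next
    case 3
    show ?thesis
    proof (cases "{k, m} \<inter> {p, q} = {}")
      case True
      \<comment> \<open>With disjoint edges, \<open>{k, m}\<close> is a component containing
        \<open>i\<close> but not \<open>j\<close>.\<close>
      then show ?thesis using 3 ij km by (intro ind[of "{k, m}"]) auto
    next
      case False
      then obtain a where a: "a \<in> {k, m}" "a \<in> {p, q}" by blast
      then have "a \<noteq> i" "a \<noteq> j" using distinct 3 by metis+
      with a 3 show ?thesis by (intro apex[of a]) auto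
    qed
  next
    case 4
    show ?thesis
    proof (cases "{k, m} \<inter> {p, q} = {}")
      case True
      then show ?thesis using 4 ij km by (intro ind[of "{k, m}"]) auto
    next
      case False
      then obtain a where a: "a \<in> {k, m}" "a \<in> {p, q}" by blast
      then have "a \<noteq> i" "a \<noteq> j" using distinct 4 by metis+
      with a 4 show ?thesis by (intro apex[of a]) auto
    qed
  qed
qed

text \<open>Two distinct edges share at most one vertex, so \<open>i\<close> or \<open>j\<close>
  lies off \<open>{k, m}\<close>; the indicator of that vertex separates.\<close>

lemma affine_double_point:
  fixes i j k m :: nat
  assumes "1 \<le> i" "i < j" "j \<le> l" "1 \<le> k" "k < m" "m \<le> l" "(k, m) \<noteq> (i, j)"
  shows "\<exists>x \<in> cspace l. x 0 = 0 \<and> x k = x m \<and> x i \<noteq> x j"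
proof -
  define v where "v = (if i \<in> {k, m} then j else i)"
  show ?thesis
    by (rule bexI[of _ "\<lambda>u. if u = v then 1 else 0"]) (use assms in \<open>auto simp: v_def cspace_def\<close>)
qed

text \<open>\<open>H1\<close> and \<open>H2\<close> may coincide, so pairs are covered along with
  triples. The cases record which of the three is the hyperplane at infinity.\<close>

lemma cone_linial_separated:
  assumes "H \<in> cone_linial l" "H1 \<in> cone_linial l" "H2 \<in> cone_linial l" "H1 \<noteq> H" "H2 \<noteq> H"
  shows "\<exists>x. x \<in> H1 \<and> x \<in> H2 \<and> x \<notin> H"
  using assms(1)
proof (cases rule: cone_linial_cases)
  case H: infinity
  from assms(2) show ?thesis
  proof (cases rule: cone_linial_cases)
    case infinity
    then show ?thesis using H assms(4) by simp
  next
    case H1: (affine i j)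
    from assms(3) show ?thesis
    proof (cases rule: cone_linial_cases)
      case infinity
      then show ?thesis using H assms(5) by simp
    next
      case H2: (affine p q)
      obtain x where "x \<in> cspace l" "x 0 = 1" "x i - x j = 1" "x p - x q = 1"
        using affine_pair_point[of i j p q l] H1 H2 by blast
      then show ?thesis unfolding H H1(1) H2(1) by (intro exI[of _ x]) auto
    qed
  qed
next
  case H: (affine i j)
  from assms(2) show ?thesis
  proof (cases rule: cone_linial_cases)
    case H1: infinity
    from assms(3) show ?thesis
    proof (cases rule: cone_linial_cases)
      case H2: infinity
      show ?thesis unfolding H(1) H1 H2
        by (rule exI[of _ "\<lambda>u. if u = i then 1 else 0"]) (use H in \<open>auto simp: cspace_def\<close>)
    next
      case H2: (affine p q)
      have "(p, q) \<noteq> (i, j)" using H(1) H2(1) assms(5) by auto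
      then obtain x where "x \<in> cspace l" "x 0 = 0" "x p = x q" "x i \<noteq> x j"
        using affine_double_point[of i j l p q] H H2 by blast
      then show ?thesis unfolding H(1) H1 H2(1) by (intro exI[of _ x]) auto
    qed
  next
    case H1: (affine k m)
    have km: "(k, m) \<noteq> (i, j)" using H(1) H1(1) assms(4) by auto
    from assms(3) show ?thesis
    proof (cases rule: cone_linial_cases)
      case H2: infinity
      obtain x where "x \<in> cspace l" "x 0 = 0" "x k = x m" "x i \<noteq> x j"
        using affine_double_point[of i j l k m] H H1 km by blast
      then show ?thesis unfolding H(1) H1(1) H2 by (intro exI[of _ x]) auto
    next
      case H2: (affine p q)
      have "(p, q) \<noteq> (i, j)" using H(1) H2(1) assms(5) by auto
      then obtain x where "x \<in> cspace l" "x k - x m = x 0" "x p - x q = x 0" "x i - x j \<noteq> x 0"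
        using affine_triple_point[of i j l k m p q] H H1 H2 km by blast
      then show ?thesis unfolding H(1) H1(1) H2(1) by (intro exI[of _ x]) auto
    qed
  qed
qed

section \<open>Independence of at most three forms\<close>

lemma cone_linial_triples_independent:
  assumes "defining_forms l (cone_linial l) n \<alpha>" "S \<subseteq> {..n}" "card S \<le> 3"
  shows "\<not> fun_space.dependent (\<alpha> ` S)"
proof (rule independent_if_separated)
  define H where "H i = {x \<in> cspace l. \<alpha> i x = 0}" for i
  have bij: "bij_betw H {..n} (cone_linial l)"
    using assms(1) unfolding H_def defining_forms_def by simp
  have mem: "H i \<in> cone_linial l" if "i \<in> S" for i
    using bij that assms(2) by (auto simp: bij_betw_def)
  have ne: "H i \<noteq> H j" if "i \<in> S" "j \<in> S" "i \<noteq> j" for i j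
    using bij that assms(2) by (metis bij_betw_imp_inj_on inj_onD subsetD)
  have fin: "finite S" using assms(2) finite_subset by blast
  then show "finite (\<alpha> ` S)" by simp
  fix f assume "f \<in> \<alpha> ` S"
  then obtain i where i: "i \<in> S" "f = \<alpha> i" by blast
  \<comment> \<open>For \<open>x\<close> in \<open>cspace l\<close>, lying outside
    \<open>H i\<close> means exactly \<open>\<alpha> i x \<noteq> 0\<close>.\<close>
  have "\<exists>x \<in> cspace l. x \<notin> H i \<and> (\<forall>j\<in>S - {i}. x \<in> H j)"
  proof (cases "S - {i} = {}")
    case True
    then show ?thesis using cone_linial_proper[OF mem[OF i(1)]] by auto
  next
    case False
    have "card (S - {i}) \<le> 2" using assms(3) fin i(1) by simp
    moreover have "card (S - {i}) \<noteq> 0" using False fin by simp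
    ultimately have "card (S - {i}) = 1 \<or> card (S - {i}) = 2" by linarith
    \<comment> \<open>Here \<open>j = k\<close> is allowed, which handles two-element
      \<open>S\<close>.\<close>
    then obtain j k where jk: "S - {i} = {j, k}"
      by (auto simp: card_2_iff card_1_singleton_iff)
    then have "j \<in> S" "k \<in> S" "j \<noteq> i" "k \<noteq> i" by auto
    then obtain x where "x \<in> H j" "x \<in> H k" "x \<notin> H i"
      using cone_linial_separated[OF mem mem mem ne ne, of i j k] i by blast
    then show ?thesis unfolding jk by (intro bexI[of _ x]) (auto simp: H_def)
  qed
  then show "\<exists>x. f x \<noteq> 0 \<and> (\<forall>g\<in>\<alpha> ` S - {f}. g x = 0)"
    using i by (auto simp: H_def)
qed

theorem theorem6p3:
  fixes l n :: nat and \<alpha> :: "nat \<Rightarrow> (nat \<Rightarrow> complex) \<Rightarrow> complex"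
  assumes "l \<ge> 1"
    and "defining_forms l (cone_linial l) n \<alpha>"
  shows "falk_phi3 n \<alpha> = 0"
  using cone_linial_triples_independent[OF assms(2)]
  by (intro falk_phi3_eq_0 os_ideal_deg_eq_0) simp

end
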